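(* Neither $\mathcal{G}$ nor $\mathcal{M}$ is unital. More strongly, for $\mathcal{P}\in\{\mathcal{G},\mathcal{M}\}$ there do not exist an object $e$ of $\mathcal{P}$ and an ordinary (not necessarily enriched) natural isomorphism $$\lambda_L:e\otimes L\xrightarrow{\ \cong\ }L\qquad(L\in\mathrm{Obj}(\mathcal{P})),$$ where naturality is between the functor $L\mapsto e\otimes L$, $\phi\mapsto\mathrm{id}_e\otimes\phi$, and the identity functor of $\mathcal{P}$.
   Context: The objects of $\mathcal{G}$ and $\mathcal{M}$ are the positive real numbers, with tensor product $a\otimes b=a+b$. The morphisms are $\mathcal{G}(a,b)=\{\text{nondecreasing homeomorphisms }[0,a]\to[0,b]\}$ and $\mathcal{M}(a,b)=\{\text{nondecreasing continuous surjections }[0,a]\to[0,b]\}$, with composition of maps; the hom-sets are topologized by the $\Delta$-kelleyfication of the relative compact-open topology (the final topology with respect to all maps from standard topological simplices continuous for that topology), which makes them categories enriched in $\mathrm{Top}$, the category of $\Delta$-generated spaces (or its full subcategory of spaces in which the image of every continuous map from $[0,1]$ is closed). For $\alpha:a\to a'$ and $\beta:b\to b'$, $\alpha\otimes\beta:[0,a+b]\to[0,a'+b']$ is $(\alpha\otimes\beta)(t)=\alpha(t)$ for $0\leq t\leq a$ and $(\alpha\otimes\beta)(t)=a'+\beta(t-a)$ for $a\leq t\leq a+b$. This is a strictly associative enriched bifunctor. A $\mathrm{Top}$-enriched category $\mathcal{C}$ with a strictly associative enriched tensor product $\otimes$ is unital if there exist an object $e$ and enriched natural isomorphisms $\lambda_X:e\otimes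 X\cong X$ and $\rho_X:X\otimes e\cong X$ satisfying the monoidal unit coherence, in particular $\mathrm{id}_X\otimes\lambda_Y=\rho_X\otimes\mathrm{id}_Y$. *)

theory Defs
  imports "HOL-Analysis.Analysis" "HOL-Homology.Simplices"
begin

section \<open>\<open>\<Delta>\<close>-generated spaces\<close>

abbreviation simplex_space :: "nat \<Rightarrow> (nat \<Rightarrow> real) topology" where
  "simplex_space p \<equiv> subtopology (powertop_real UNIV) (standard_simplex p)"

definition delta_open :: "'a topology \<Rightarrow> 'a set \<Rightarrow> bool" where
  "delta_open X U \<longleftrightarrow> U \<subseteq> topspace X \<and>
     (\<forall>p \<sigma>. continuous_map (simplex_space p) X \<sigma> \<longrightarrow>
        openin (simplex_space p) {x \<in> standard_simplex p. \<sigma> x \<in> U})"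

definition delta_kelleyfication :: "'a topology \<Rightarrow> 'a topology" where
  "delta_kelleyfication X = topology (delta_open X)"

definition delta_generated :: "'a topology \<Rightarrow> bool" where
  "delta_generated X \<longleftrightarrow> delta_kelleyfication X = X"

lemma istopology_delta_open: "istopology (delta_open X)"
  unfolding istopology_def
proof (intro conjI allI impI)
  fix S T assume "delta_open X S" "delta_open X T"
  moreover have "{x \<in> standard_simplex p. \<sigma> x \<in> S \<inter> T} =
      {x \<in> standard_simplex p. \<sigma> x \<in> S} \<inter> {x \<in> standard_simplex p. \<sigma> x \<in> T}" for p \<sigma>
    by auto
  ultimately show "delta_open X (S \<inter> T)"
    unfolding delta_open_def by (simp add: openin_Int le_infI1)
next
  fix \<K> assume "\<forall>K\<in>\<K>. delta_open X K"
  moreover have "{x \<in> standard_simplex p. \<sigma> x \<in> \<Union>\<K>} =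
      (\<Union>K\<in>\<K>. {x \<in> standard_simplex p. \<sigma> x \<in> K})" for p \<sigma>
    by auto
  ultimately show "delta_open X (\<Union>\<K>)"
    unfolding delta_open_def by (auto intro!: openin_Union)
qed

lemma openin_delta_kelleyfication: "openin (delta_kelleyfication X) U \<longleftrightarrow> delta_open X U"
  by (simp add: delta_kelleyfication_def istopology_delta_open topology_inverse')

lemma openin_imp_delta_open: "openin X U \<Longrightarrow> delta_open X U"
  unfolding delta_open_def
  using openin_continuous_map_preimage openin_subset topspace_standard_simplex by fastforce

lemma topspace_delta_kelleyfication [simp]: "topspace (delta_kelleyfication X) = topspace X"
proof
  show "topspace (delta_kelleyfication X) \<subseteq> topspace X"
    using openin_delta_kelleyfication [of X "topspace (delta_kelleyfication X)"]
    by (simp add: delta_open_def)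
  show "topspace X \<subseteq> topspace (delta_kelleyfication X)"
    by (simp add: openin_delta_kelleyfication openin_imp_delta_open openin_subset)
qed

lemma continuous_map_simplex_delta_kelleyfication:
  "continuous_map (simplex_space p) (delta_kelleyfication X) \<sigma> \<longleftrightarrow>
   continuous_map (simplex_space p) X \<sigma>"
proof
  assume "continuous_map (simplex_space p) (delta_kelleyfication X) \<sigma>"
  then show "continuous_map (simplex_space p) X \<sigma>"
    unfolding continuous_map_def
    by (simp add: openin_delta_kelleyfication openin_imp_delta_open)
next
  assume "continuous_map (simplex_space p) X \<sigma>"
  then show "continuous_map (simplex_space p) (delta_kelleyfication X) \<sigma>"
    unfolding continuous_map_def [of _ "delta_kelleyfication X"] openin_delta_kelleyfication
      delta_open_def
    by (auto simp: continuous_map_def)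
qed

lemma delta_generated_delta_kelleyfication [simp]: "delta_generated (delta_kelleyfication X)"
  unfolding delta_generated_def topology_eq openin_delta_kelleyfication
  by (simp add: delta_open_def continuous_map_simplex_delta_kelleyfication)

lemma continuous_map_delta_kelleyfication:
  assumes "continuous_map X Y f"
  shows "continuous_map (delta_kelleyfication X) (delta_kelleyfication Y) f"
  unfolding continuous_map_def openin_delta_kelleyfication
proof (intro conjI allI impI)
  show "f \<in> topspace (delta_kelleyfication X) \<rightarrow> topspace (delta_kelleyfication Y)"
    using assms by (simp add: continuous_map_def)
next
  fix U assume U: "delta_open Y U"
  have "openin (simplex_space p) {x \<in> standard_simplex p. \<sigma> x \<in> topspace X \<and> f (\<sigma> x) \<in> U}"
    if "continuous_map (simplex_space p) X \<sigma>" for p \<sigma>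
  proof -
    have "openin (simplex_space p) {x \<in> standard_simplex p. (f \<circ> \<sigma>) x \<in> U}"
      using U continuous_map_compose [OF that assms] unfolding delta_open_def by blast
    moreover have "\<sigma> x \<in> topspace X" if "x \<in> standard_simplex p" for x
      using \<open>continuous_map (simplex_space p) X \<sigma>\<close> that by (auto simp: continuous_map_def Pi_iff)
    then have "{x \<in> standard_simplex p. (f \<circ> \<sigma>) x \<in> U} =
        {x \<in> standard_simplex p. \<sigma> x \<in> topspace X \<and> f (\<sigma> x) \<in> U}"
      by auto
    ultimately show ?thesis by simp
  qed
  then show "delta_open X {x \<in> topspace (delta_kelleyfication X). f x \<in> U}"
    by (auto simp: delta_open_def)
qed

lemma continuous_map_from_delta_kelleyfication:
  "continuous_map X Y f \<Longrightarrow> continuous_map (delta_kelleyfication X) Y f"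
  by (auto simp: continuous_map_def openin_delta_kelleyfication openin_imp_delta_open)

text \<open>The categorical product of the category of \<open>\<Delta>\<close>-generated spaces.\<close>

definition delta_prod :: "'a topology \<Rightarrow> 'b topology \<Rightarrow> ('a \<times> 'b) topology" where
  "delta_prod X Y = delta_kelleyfication (prod_topology X Y)"

lemma continuous_map_delta_prod:
  assumes "continuous_map (prod_topology X Y) Z f"
  shows "continuous_map (delta_prod (delta_kelleyfication X) (delta_kelleyfication Y))
           (delta_kelleyfication Z) f"
proof -
  have "continuous_map (prod_topology (delta_kelleyfication X) (delta_kelleyfication Y))
          (prod_topology X Y) id"
  proof -
    have X: "continuous_map (delta_kelleyfication X) X id"
      and Y: "continuous_map (delta_kelleyfication Y) Y id"
      by (simp_all add: continuous_map_from_delta_kelleyfication)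
    show ?thesis
      unfolding continuous_map_pairwise
      using continuous_map_compose [OF continuous_map_fst [of _ "delta_kelleyfication Y"] X]
        continuous_map_compose [OF continuous_map_snd [of "delta_kelleyfication X"] Y]
      by simp
  qed
  from continuous_map_compose [OF this assms] show ?thesis
    unfolding delta_prod_def by (simp add: continuous_map_delta_kelleyfication)
qed

text \<open>Maps are extensional, so that equality of functions is equality of maps.\<close>

definition compact_open_topology :: "'a topology \<Rightarrow> 'b topology \<Rightarrow> ('a \<Rightarrow> 'b) topology" where
  "compact_open_topology X Y = topology_generated_by
     {{f \<in> extensional (topspace X). continuous_map X Y f \<and> f ` K \<subseteq> U} | K U.
        compactin X K \<and> openin Y U}"

lemma topspace_compact_open_topology [simp]:
  "topspace (compact_open_topology X Y) = {f \<in> extensional (topspace X). continuous_map X Y f}"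
proof -
  have "{f \<in> extensional (topspace X). continuous_map X Y f} =
      {f \<in> extensional (topspace X). continuous_map X Y f \<and> f ` {} \<subseteq> {}}"
    by simp
  moreover have "compactin X {}" "openin Y {}"
    by simp_all
  ultimately show ?thesis
    unfolding compact_open_topology_def topology_generated_by_topspace by blast
qed

lemma openin_compact_open_topology:
  assumes "compactin X K" "openin Y U"
  shows "openin (compact_open_topology X Y)
           {f \<in> extensional (topspace X). continuous_map X Y f \<and> f ` K \<subseteq> U}"
  unfolding compact_open_topology_def using assms by (intro topology_generated_by_Basis) blast

lemma continuous_map_compact_open_topology:
  assumes "\<And>t. t \<in> topspace T \<Longrightarrow> F t \<in> extensional (topspace X) \<and> continuous_map X Y (F t)"
    and "\<And>K U. \<lbrakk>compactin X K; openin Y U\<rbrakk> \<Longrightarrow> openin T {t \<in> topspace T. F t ` K \<subseteq> U}"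
  shows "continuous_map T (compact_open_topology X Y) F"
proof -
  have "F -` {f \<in> extensional (topspace X). continuous_map X Y f \<and> f ` K \<subseteq> U} \<inter> topspace T =
      {t \<in> topspace T. F t ` K \<subseteq> U}" for K U
    using assms(1) by auto
  moreover have "F ` topspace T \<subseteq> topspace (compact_open_topology X Y)"
    using assms(1) by auto
  ultimately show ?thesis
    unfolding compact_open_topology_def
    by (intro continuous_on_generated_topo)
      (use assms(2) in \<open>auto simp flip: compact_open_topology_def\<close>)
qed

lemma continuous_map_compose_compact_open:
  assumes "compact_space Y" "Hausdorff_space Y"
  shows "continuous_map (prod_topology (compact_open_topology Y Z) (compact_open_topology X Y))
           (compact_open_topology X Z) (\<lambda>(g, f). compose (topspace X) g f)"
    (is "continuous_map ?T _ ?F")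
proof (rule continuous_map_compact_open_topology)
  fix t assume "t \<in> topspace ?T"
  then obtain g f where t: "t = (g, f)" "continuous_map Y Z g" "continuous_map X Y f"
    by auto
  have "continuous_map X Z (compose (topspace X) g f)"
    by (rule continuous_map_eq [OF continuous_map_compose [OF t(3,2)]]) (auto simp: compose_def)
  then show "?F t \<in> extensional (topspace X) \<and> continuous_map X Z (?F t)"
    by (simp add: t)
next
  fix K U assume K: "compactin X K" and U: "openin Z U"
  show "openin ?T {t \<in> topspace ?T. ?F t ` K \<subseteq> U}"
  proof (subst openin_subopen, safe)
    fix g f assume gf: "(g, f) \<in> topspace ?T" and sub: "compose (topspace X) g f ` K \<subseteq> U"
    then have g: "continuous_map Y Z g" and f: "continuous_map X Y f"
      by auto
    have KX: "K \<subseteq> topspace X"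
      using K compactin_subset_topspace by blast
    define V where "V = {y \<in> topspace Y. g y \<in> U}"
    have V: "openin Y V"
      unfolding V_def using g U by (rule openin_continuous_map_preimage)
    have fK: "compactin Y (f ` K)"
      using K f by (rule image_compactin)
    have "f ` K \<subseteq> V"
    proof
      fix y assume "y \<in> f ` K"
      then obtain x where x: "x \<in> K" "y = f x" by auto
      then have "compose (topspace X) g f x \<in> U" using sub by blast
      moreover have "f x \<in> topspace Y" using f x KX by (auto simp: continuous_map_def Pi_iff)
      ultimately show "y \<in> V"
        using x KX by (auto simp: V_def compose_def)
    qed
    moreover have "closedin Y (f ` K)"
      using assms(2) fK compactin_imp_closedin by blast
    moreover have "closedin Y (topspace Y - V)"
      using V by blast
    moreover have "normal_space Y"
      using assms compact_Hausdorff_or_regular_imp_normal_space by blast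
    ultimately obtain W W' where W: "openin Y W" "openin Y W'" "f ` K \<subseteq> W"
        "topspace Y - V \<subseteq> W'" "disjnt W W'"
      unfolding normal_space_def by (meson Diff_disjoint disjnt_def disjnt_subset1 disjnt_sym
          disjnt_Diff1 order_refl)
    define L where "L = topspace Y - W'"
    have L: "compactin Y L"
      unfolding L_def using assms(1) W(2) by (simp add: closedin_compact_space closedin_diff)
    have WL: "W \<subseteq> L" and LV: "L \<subseteq> V"
      using W openin_subset [OF W(1)] by (auto simp: L_def disjnt_iff)
    define A where "A = {g \<in> extensional (topspace Y). continuous_map Y Z g \<and> g ` L \<subseteq> U}"
    define B where "B = {f \<in> extensional (topspace X). continuous_map X Y f \<and> f ` K \<subseteq> W}"
    have "openin ?T (A \<times> B)"
      unfolding A_def B_def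
      by (simp add: openin_prod_Times_iff openin_compact_open_topology K U L W)
    moreover have "(g, f) \<in> A \<times> B"
      using gf W(3) LV by (auto simp: A_def B_def V_def)
    moreover have "A \<times> B \<subseteq> {t \<in> topspace ?T. ?F t ` K \<subseteq> U}"
      using WL KX by (force simp: A_def B_def compose_def)
    ultimately show "\<exists>S. openin ?T S \<and> (g, f) \<in> S \<and> S \<subseteq> {t \<in> topspace ?T. ?F t ` K \<subseteq> U}"
      by blast
  qed
qed


section \<open>Categories enriched in \<open>\<Delta>\<close>-generated spaces\<close>

text \<open>
  The elements of \<open>Hom C X Y\<close> need not determine \<open>X\<close> and \<open>Y\<close>, so composition and the tensor
  product of morphisms carry the objects as arguments: \<open>Comp C X Y Z g f\<close> is \<open>g \<circ> f\<close> for
  \<open>f : X \<rightarrow> Y\<close> and \<open>g : Y \<rightarrow> Z\<close>, and \<open>TMor C X X' Y Y' f g\<close> is \<open>f \<otimes> g\<close> for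
  \<open>f : X \<rightarrow> X'\<close> and \<open>g : Y \<rightarrow> Y'\<close>.
\<close>

record ('o, 'm) top_category =
  Obj :: "'o set"
  Hom :: "'o \<Rightarrow> 'o \<Rightarrow> 'm topology"
  Ident :: "'o \<Rightarrow> 'm"
  Comp :: "'o \<Rightarrow> 'o \<Rightarrow> 'o \<Rightarrow> 'm \<Rightarrow> 'm \<Rightarrow> 'm"

record ('o, 'm) top_tensor_category = "('o, 'm) top_category" +
  TObj :: "'o \<Rightarrow> 'o \<Rightarrow> 'o"
  TMor :: "'o \<Rightarrow> 'o \<Rightarrow> 'o \<Rightarrow> 'o \<Rightarrow> 'm \<Rightarrow> 'm \<Rightarrow> 'm"

abbreviation Mor :: "('o, 'm, 'z) top_category_scheme \<Rightarrow> 'o \<Rightarrow> 'o \<Rightarrow> 'm set" where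
  "Mor C X Y \<equiv> topspace (Hom C X Y)"

definition enriched_category :: "('o, 'm, 'z) top_category_scheme \<Rightarrow> bool" where
  "enriched_category C \<longleftrightarrow>
     (\<forall>X\<in>Obj C. \<forall>Y\<in>Obj C. delta_generated (Hom C X Y)) \<and>
     (\<forall>X\<in>Obj C. Ident C X \<in> Mor C X X) \<and>
     (\<forall>X\<in>Obj C. \<forall>Y\<in>Obj C. \<forall>Z\<in>Obj C.
        continuous_map (delta_prod (Hom C Y Z) (Hom C X Y)) (Hom C X Z)
          (\<lambda>(g, f). Comp C X Y Z g f)) \<and>
     (\<forall>X\<in>Obj C. \<forall>Y\<in>Obj C. \<forall>f\<in>Mor C X Y.
        Comp C X X Y f (Ident C X) = f \<and> Comp C X Y Y (Ident C Y) f = f) \<and>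
     (\<forall>W\<in>Obj C. \<forall>X\<in>Obj C. \<forall>Y\<in>Obj C. \<forall>Z\<in>Obj C.
        \<forall>f\<in>Mor C W X. \<forall>g\<in>Mor C X Y. \<forall>h\<in>Mor C Y Z.
          Comp C W Y Z h (Comp C W X Y g f) = Comp C W X Z (Comp C X Y Z h g) f)"

text \<open>A strictly associative enriched bifunctor \<open>C \<times> C \<rightarrow> C\<close>.\<close>

definition enriched_tensor_category :: "('o, 'm, 'z) top_tensor_category_scheme \<Rightarrow> bool" where
  "enriched_tensor_category C \<longleftrightarrow> enriched_category C \<and>
     (\<forall>X\<in>Obj C. \<forall>Y\<in>Obj C. TObj C X Y \<in> Obj C) \<and>
     (\<forall>X\<in>Obj C. \<forall>X'\<in>Obj C. \<forall>Y\<in>Obj C. \<forall>Y'\<in>Obj C.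
        continuous_map (delta_prod (Hom C X X') (Hom C Y Y')) (Hom C (TObj C X Y) (TObj C X' Y'))
          (\<lambda>(f, g). TMor C X X' Y Y' f g)) \<and>
     (\<forall>X\<in>Obj C. \<forall>Y\<in>Obj C.
        TMor C X X Y Y (Ident C X) (Ident C Y) = Ident C (TObj C X Y)) \<and>
     (\<forall>X\<in>Obj C. \<forall>X'\<in>Obj C. \<forall>X''\<in>Obj C. \<forall>Y\<in>Obj C. \<forall>Y'\<in>Obj C. \<forall>Y''\<in>Obj C.
        \<forall>f\<in>Mor C X X'. \<forall>f'\<in>Mor C X' X''. \<forall>g\<in>Mor C Y Y'. \<forall>g'\<in>Mor C Y' Y''.
          TMor C X X'' Y Y'' (Comp C X X' X'' f' f) (Comp C Y Y' Y'' g' g) =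
          Comp C (TObj C X Y) (TObj C X' Y') (TObj C X'' Y'')
            (TMor C X' X'' Y' Y'' f' g') (TMor C X X' Y Y' f g)) \<and>
     (\<forall>X\<in>Obj C. \<forall>Y\<in>Obj C. \<forall>Z\<in>Obj C. TObj C (TObj C X Y) Z = TObj C X (TObj C Y Z)) \<and>
     (\<forall>X\<in>Obj C. \<forall>X'\<in>Obj C. \<forall>Y\<in>Obj C. \<forall>Y'\<in>Obj C. \<forall>Z\<in>Obj C. \<forall>Z'\<in>Obj C.
        \<forall>f\<in>Mor C X X'. \<forall>g\<in>Mor C Y Y'. \<forall>h\<in>Mor C Z Z'.
          TMor C (TObj C X Y) (TObj C X' Y') Z Z' (TMor C X X' Y Y' f g) h =
          TMor C X X' (TObj C Y Z) (TObj C Y' Z') f (TMor C Y Y' Z Z' g h))"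

record ('o, 'm, 'p, 'n) functor_data =
  FObj :: "'o \<Rightarrow> 'p"
  FMor :: "'o \<Rightarrow> 'o \<Rightarrow> 'm \<Rightarrow> 'n"

definition enriched_functor ::
  "('o, 'm, 'y) top_category_scheme \<Rightarrow> ('p, 'n, 'z) top_category_scheme \<Rightarrow>
   ('o, 'm, 'p, 'n) functor_data \<Rightarrow> bool" where
  "enriched_functor C D F \<longleftrightarrow>
     (\<forall>X\<in>Obj C. FObj F X \<in> Obj D) \<and>
     (\<forall>X\<in>Obj C. \<forall>Y\<in>Obj C. continuous_map (Hom C X Y) (Hom D (FObj F X) (FObj F Y)) (FMor F X Y)) \<and>
     (\<forall>X\<in>Obj C. FMor F X X (Ident C X) = Ident D (FObj F X)) \<and>
     (\<forall>X\<in>Obj C. \<forall>Y\<in>Obj C. \<forall>Z\<in>Obj C. \<forall>f\<in>Mor C X Y. \<forall>g\<in>Mor C Y Z.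
        FMor F X Z (Comp C X Y Z g f) =
        Comp D (FObj F X) (FObj F Y) (FObj F Z) (FMor F Y Z g) (FMor F X Y f))"

definition isomorphism :: "('o, 'm, 'z) top_category_scheme \<Rightarrow> 'o \<Rightarrow> 'o \<Rightarrow> 'm \<Rightarrow> bool" where
  "isomorphism C X Y f \<longleftrightarrow> f \<in> Mor C X Y \<and>
     (\<exists>g\<in>Mor C Y X. Comp C X Y X g f = Ident C X \<and> Comp C Y X Y f g = Ident C Y)"

definition natural_isomorphism ::
  "('o, 'm, 'y) top_category_scheme \<Rightarrow> ('p, 'n, 'z) top_category_scheme \<Rightarrow>
   ('o, 'm, 'p, 'n) functor_data \<Rightarrow> ('o, 'm, 'p, 'n) functor_data \<Rightarrow> ('o \<Rightarrow> 'n) \<Rightarrow> bool" where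
  "natural_isomorphism C D F G \<eta> \<longleftrightarrow>
     (\<forall>X\<in>Obj C. isomorphism D (FObj F X) (FObj G X) (\<eta> X)) \<and>
     (\<forall>X\<in>Obj C. \<forall>Y\<in>Obj C. \<forall>f\<in>Mor C X Y.
        Comp D (FObj F X) (FObj F Y) (FObj G Y) (\<eta> Y) (FMor F X Y f) =
        Comp D (FObj F X) (FObj G X) (FObj G Y) (FMor G X Y f) (\<eta> X))"

text \<open>
  A component of an enriched transformation is a map from the one-point space to a hom-space,
  i.e. a point of it, and the enriched naturality condition is the equality of two continuous
  maps \<open>Hom C X Y \<rightarrow> Hom D (F X) (G Y)\<close>, which is tested on points.
\<close>

definition enriched_natural_isomorphism ::
  "('o, 'm, 'y) top_category_scheme \<Rightarrow> ('p, 'n, 'z) top_category_scheme \<Rightarrow>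
   ('o, 'm, 'p, 'n) functor_data \<Rightarrow> ('o, 'm, 'p, 'n) functor_data \<Rightarrow> ('o \<Rightarrow> 'n) \<Rightarrow> bool" where
  "enriched_natural_isomorphism C D F G \<eta> \<longleftrightarrow>
     enriched_functor C D F \<and> enriched_functor C D G \<and> natural_isomorphism C D F G \<eta>"

definition id_functor :: "('o, 'm, 'o, 'm) functor_data" where
  "id_functor = \<lparr>FObj = (\<lambda>X. X), FMor = (\<lambda>X Y f. f)\<rparr>"

definition left_tensor ::
  "('o, 'm, 'z) top_tensor_category_scheme \<Rightarrow> 'o \<Rightarrow> ('o, 'm, 'o, 'm) functor_data" where
  "left_tensor C e =
     \<lparr>FObj = (\<lambda>X. TObj C e X), FMor = (\<lambda>X Y f. TMor C e e X Y (Ident C e) f)\<rparr>"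

definition right_tensor ::
  "('o, 'm, 'z) top_tensor_category_scheme \<Rightarrow> 'o \<Rightarrow> ('o, 'm, 'o, 'm) functor_data" where
  "right_tensor C e =
     \<lparr>FObj = (\<lambda>X. TObj C X e), FMor = (\<lambda>X Y f. TMor C X Y e e f (Ident C e))\<rparr>"

text \<open>
  The associator is the identity, so the triangle axiom reads \<open>id\<^sub>X \<otimes> \<lambda>\<^sub>Y = \<rho>\<^sub>X \<otimes> id\<^sub>Y\<close>;
  the remaining unit coherences are consequences of it (Kelly).
\<close>

definition unital :: "('o, 'm, 'z) top_tensor_category_scheme \<Rightarrow> bool" where
  "unital C \<longleftrightarrow> (\<exists>e\<in>Obj C. \<exists>lam rho.
     enriched_natural_isomorphism C C (left_tensor C e) id_functor lam \<and>
     enriched_natural_isomorphism C C (right_tensor C e) id_functor rho \<and>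
     (\<forall>X\<in>Obj C. \<forall>Y\<in>Obj C.
        TMor C X X (TObj C e Y) Y (Ident C X) (lam Y) =
        TMor C (TObj C X e) X Y Y (rho X) (Ident C Y)))"


section \<open>The categories \<open>\<G>\<close> and \<open>\<M>\<close>\<close>

abbreviation interval :: "real \<Rightarrow> real topology" where
  "interval a \<equiv> top_of_set {0..a}"

definition G_maps :: "real \<Rightarrow> real \<Rightarrow> (real \<Rightarrow> real) set" where
  "G_maps a b = {f \<in> extensional {0..a}.
     mono_on {0..a} f \<and> homeomorphic_map (interval a) (interval b) f}"

definition M_maps :: "real \<Rightarrow> real \<Rightarrow> (real \<Rightarrow> real) set" where
  "M_maps a b = {f \<in> extensional {0..a}.
     mono_on {0..a} f \<and> continuous_on {0..a} f \<and> f ` {0..a} = {0..b}}"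

definition tensor_map ::
  "real \<Rightarrow> real \<Rightarrow> real \<Rightarrow> real \<Rightarrow> (real \<Rightarrow> real) \<Rightarrow> (real \<Rightarrow> real) \<Rightarrow> (real \<Rightarrow> real)" where
  "tensor_map a a' b b' \<alpha> \<beta> =
     (\<lambda>t\<in>{0..a+b}. if t \<le> a then \<alpha> t else a' + \<beta> (t - a))"

definition interval_category ::
  "(real \<Rightarrow> real \<Rightarrow> (real \<Rightarrow> real) set) \<Rightarrow> (real, real \<Rightarrow> real) top_tensor_category" where
  "interval_category H =
     \<lparr>Obj = {0<..},
      Hom = (\<lambda>a b. delta_kelleyfication
                     (subtopology (compact_open_topology (interval a) (interval b)) (H a b))),
      Ident = (\<lambda>a. \<lambda>t\<in>{0..a}. t),
      Comp = (\<lambda>a b c g f. compose {0..a} g f),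
      TObj = (\<lambda>a b. a + b),
      TMor = tensor_map\<rparr>"

definition G_cat :: "(real, real \<Rightarrow> real) top_tensor_category" where
  "G_cat = interval_category G_maps"

definition M_cat :: "(real, real \<Rightarrow> real) top_tensor_category" where
  "M_cat = interval_category M_maps"

subsection \<open>\<open>\<G>\<close> and \<open>\<M>\<close> are enriched tensor categories\<close>

lemma G_maps_iff: "f \<in> G_maps a b \<longleftrightarrow> f \<in> M_maps a b \<and> inj_on f {0..a}"
proof
  assume "f \<in> G_maps a b"
  then show "f \<in> M_maps a b \<and> inj_on f {0..a}"
    by (auto simp: G_maps_def M_maps_def homeomorphic_eq_everything_map)
next
  assume f: "f \<in> M_maps a b \<and> inj_on f {0..a}"
  then have "homeomorphic_map (interval a) (interval b) f"
    by (intro continuous_imp_homeomorphic_map)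
      (auto simp: M_maps_def compact_space_subtopology compactin_subtopology Hausdorff_space_subtopology)
  with f show "f \<in> G_maps a b" by (simp add: G_maps_def M_maps_def)
qed

lemma M_maps_continuous_map: "f \<in> M_maps a b \<Longrightarrow> continuous_map (interval a) (interval b) f"
  by (auto simp: M_maps_def)

lemma M_maps_compact_open:
  "M_maps a b \<subseteq> topspace (compact_open_topology (interval a) (interval b))"
proof
  fix f assume "f \<in> M_maps a b"
  with M_maps_continuous_map [OF this]
  show "f \<in> topspace (compact_open_topology (interval a) (interval b))"
    unfolding topspace_compact_open_topology by (simp add: M_maps_def)
qed

lemma M_maps_bounds:
  assumes "f \<in> M_maps a b" "0 \<le> t" "t \<le> a" shows "0 \<le> f t \<and> f t \<le> b"
proof -
  have "f t \<in> f ` {0..a}" using assms by simp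
  then show ?thesis using assms(1) by (simp add: M_maps_def)
qed

lemma M_maps_ends:
  assumes "f \<in> M_maps a b" "0 < a" "0 < b" shows "f 0 = 0" "f a = b"
proof -
  have im: "f ` {0..a} = {0..b}" and m: "mono_on {0..a} f"
    using assms by (auto simp: M_maps_def)
  have z: "0 \<in> f ` {0..a}" and b: "b \<in> f ` {0..a}"
    using im assms by simp_all
  from z obtain s where "s \<in> {0..a}" "0 = f s" by (rule imageE) simp
  moreover from b obtain t where "t \<in> {0..a}" "b = f t" by (rule imageE) simp
  ultimately show "f 0 = 0" "f a = b"
    using mono_onD [OF m, of 0 s] mono_onD [OF m, of t a] assms
      M_maps_bounds [OF assms(1), of 0] M_maps_bounds [OF assms(1), of a]
    by auto
qed

lemma M_maps_ident: "(\<lambda>t\<in>{0..a}. t) \<in> M_maps a a"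
  by (auto simp: M_maps_def mono_on_def intro: continuous_on_eq [OF continuous_on_id])

lemma M_maps_compose:
  assumes f: "f \<in> M_maps a b" and g: "g \<in> M_maps b c"
  shows "compose {0..a} g f \<in> M_maps a c"
proof -
  have fi: "f ` {0..a} = {0..b}" and gi: "g ` {0..b} = {0..c}"
    using f g by (auto simp: M_maps_def)
  have "continuous_on {0..a} (g \<circ> f)"
    using f g by (intro continuous_on_compose) (auto simp: M_maps_def)
  then have "continuous_on {0..a} (compose {0..a} g f)"
    by (rule continuous_on_eq) (simp add: compose_def)
  moreover have "mono_on {0..a} (compose {0..a} g f)"
    using f g M_maps_bounds [OF f] by (auto simp: M_maps_def mono_on_def compose_def)
  moreover have "compose {0..a} g f ` {0..a} = g ` f ` {0..a}"
    by (auto simp: compose_def image_iff)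
  ultimately show ?thesis
    by (simp add: M_maps_def fi gi)
qed

lemma tensor_map_cases:
  assumes "\<alpha> \<in> M_maps a a'" "\<beta> \<in> M_maps b b'" "0 < a" "0 < a'" "0 < b" "0 < b'"
  shows "t \<in> {0..a} \<Longrightarrow> tensor_map a a' b b' \<alpha> \<beta> t = \<alpha> t"
    and "t \<in> {a..a+b} \<Longrightarrow> tensor_map a a' b b' \<alpha> \<beta> t = a' + \<beta> (t - a)"
  using M_maps_ends [OF assms(1)] M_maps_ends [OF assms(2)] assms
  by (auto simp: tensor_map_def)

lemma M_maps_tensor:
  assumes al: "\<alpha> \<in> M_maps a a'" and be: "\<beta> \<in> M_maps b b'"
    and pos: "0 < a" "0 < a'" "0 < b" "0 < b'"
  shows "tensor_map a a' b b' \<alpha> \<beta> \<in> M_maps (a + b) (a' + b')"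
proof -
  let ?T = "tensor_map a a' b b' \<alpha> \<beta>"
  note c = tensor_map_cases [OF al be pos]
  have un: "{0..a+b} = {0..a} \<union> {a..a+b}" using pos by auto
  have "continuous_on {0..a} ?T"
    by (rule continuous_on_eq [of _ \<alpha>]) (use al c in \<open>auto simp: M_maps_def\<close>)
  moreover have "continuous_on {a..a+b} ?T"
  proof (rule continuous_on_eq [of _ "\<lambda>t. a' + \<beta> (t - a)"])
    have "continuous_on {0..b} \<beta>"
      using be by (simp add: M_maps_def)
    moreover have "continuous_on {a..a+b} (\<lambda>t. t - a)"
      by (intro continuous_intros)
    ultimately have "continuous_on {a..a+b} (\<lambda>t. \<beta> (t - a))"
      by (rule continuous_on_compose2) auto
    then show "continuous_on {a..a+b} (\<lambda>t. a' + \<beta> (t - a))"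
      by (intro continuous_on_add continuous_on_const)
  qed (simp add: c(2))
  ultimately have 1: "continuous_on {0..a+b} ?T"
    unfolding un by (intro continuous_on_closed_Un closed_atLeastAtMost)
  have 2: "mono_on {0..a+b} ?T"
  proof (rule mono_onI)
    fix s t assume st: "s \<in> {0..a+b}" "t \<in> {0..a+b}" "s \<le> t"
    have ma: "mono_on {0..a} \<alpha>" and mb: "mono_on {0..b} \<beta>"
      using al be by (auto simp: M_maps_def)
    consider "t \<le> a" | "s \<le> a" "a \<le> t" | "a \<le> s" by linarith
    then show "?T s \<le> ?T t"
    proof cases
      case 1 then show ?thesis using st c mono_onD [OF ma, of s t] by simp
    next
      case 2
      then show ?thesis
        using st c M_maps_bounds [OF al, of s] M_maps_bounds [OF be, of "t - a"] by simp
    next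
      case 3 then show ?thesis using st c mono_onD [OF mb, of "s - a" "t - a"] by simp
    qed
  qed
  have "?T ` {0..a} = {0..a'}"
    using al c by (simp add: M_maps_def cong: image_cong_simp)
  moreover have "?T ` {a..a+b} = {a'..a'+b'}"
  proof -
    have "?T ` {a..a+b} = (\<lambda>t. a' + \<beta> (t - a)) ` {a..a+b}"
      using c by (simp cong: image_cong_simp)
    also have "\<dots> = (+) a' ` \<beta> ` {0..b}"
    proof -
      have "{0..b} = (\<lambda>t. t - a) ` {a..a+b}"
        using image_diff_atLeastAtMost [of a a "a+b"] by simp
      then show ?thesis by (simp only: image_image)
    qed
    also have "\<beta> ` {0..b} = {0..b'}" using be by (simp add: M_maps_def)
    finally show ?thesis by (simp add: add.commute)
  qed
  ultimately have 3: "?T ` {0..a+b} = {0..a'+b'}"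
    unfolding un image_Un using pos by auto
  show ?thesis
    using 1 2 3 by (simp add: M_maps_def) (simp add: tensor_map_def)
qed

lemma G_maps_tensor:
  assumes al: "\<alpha> \<in> G_maps a a'" and be: "\<beta> \<in> G_maps b b'"
    and pos: "0 < a" "0 < a'" "0 < b" "0 < b'"
  shows "tensor_map a a' b b' \<alpha> \<beta> \<in> G_maps (a + b) (a' + b')"
proof -
  let ?T = "tensor_map a a' b b' \<alpha> \<beta>"
  have M: "\<alpha> \<in> M_maps a a'" "\<beta> \<in> M_maps b b'" and inj: "inj_on \<alpha> {0..a}" "inj_on \<beta> {0..b}"
    using al be by (auto simp: G_maps_iff)
  note c = tensor_map_cases [OF M pos]
  have T: "?T \<in> M_maps (a + b) (a' + b')"
    by (rule M_maps_tensor [OF M pos])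
  have "s = t" if st: "s \<in> {0..a+b}" "t \<in> {0..a+b}" "?T s = ?T t" "s \<le> t" for s t
  proof -
    consider "t \<le> a" | "s < a" "a < t" | "a \<le> s" using st by linarith
    then show ?thesis
    proof cases
      case 1 then show ?thesis using st c inj_onD [OF inj(1), of s t] by simp
    next
      case 2
      have "\<alpha> s \<noteq> \<alpha> a" using inj_onD [OF inj(1), of s a] 2 st pos by force
      then have "\<alpha> s < a'"
        using M_maps_bounds [OF M(1), of s] M_maps_ends [OF M(1)] pos 2 st by force
      then show ?thesis
        using st 2 c M_maps_bounds [OF M(2), of "t - a"] by simp
    next
      case 3 then show ?thesis using st c inj_onD [OF inj(2), of "s - a" "t - a"] by simp
    qed
  qed
  note le = this
  have "inj_on ?T {0..a+b}"
  proof (rule inj_onI)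
    fix s t assume "s \<in> {0..a+b}" "t \<in> {0..a+b}" "?T s = ?T t"
    with le [of s t] le [of t s] show "s = t"
      using linear [of s t] by argo
  qed
  with T show ?thesis by (simp add: G_maps_iff)
qed

lemma continuous_map_tensor_map:
  assumes pos: "0 < a" "0 < a'" "0 < b" "0 < b'"
  defines "T \<equiv> prod_topology
      (subtopology (compact_open_topology (interval a) (interval a')) (M_maps a a'))
      (subtopology (compact_open_topology (interval b) (interval b')) (M_maps b b'))"
  shows "continuous_map T (compact_open_topology (interval (a + b)) (interval (a' + b')))
           (\<lambda>(\<alpha>, \<beta>). tensor_map a a' b b' \<alpha> \<beta>)"
    (is "continuous_map _ _ ?F")
proof (rule continuous_map_compact_open_topology)
  fix t assume "t \<in> topspace T"
  then obtain \<alpha> \<beta> where "t = (\<alpha>, \<beta>)" "\<alpha> \<in> M_maps a a'" "\<beta> \<in> M_maps b b'"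
    by (auto simp: T_def)
  with M_maps_tensor [OF this(2,3) pos]
  show "?F t \<in> extensional (topspace (interval (a + b))) \<and>
      continuous_map (interval (a + b)) (interval (a' + b')) (?F t)"
    by (auto simp: M_maps_def)
next
  fix K U
  assume K: "compactin (interval (a + b)) K" and U: "openin (interval (a' + b')) U"
  have K': "compact K" "K \<subseteq> {0..a+b}"
    using K by (auto simp: compactin_subtopology)
  obtain V where V: "open V" "U = {0..a'+b'} \<inter> V"
    using U by (auto simp: openin_open)
  define K1 where "K1 = K \<inter> {0..a}"
  define K2 where "K2 = (\<lambda>t. t - a) ` (K \<inter> {a..a+b})"
  define U1 where "U1 = {0..a'} \<inter> V"
  define U2 where "U2 = {0..b'} \<inter> (\<lambda>t. a' + t) -` V"
  have K1: "compactin (interval a) K1"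
    using K' by (auto simp: compactin_subtopology K1_def compact_Int_closed)
  have "compact K2"
    unfolding K2_def using K'
    by (intro compact_continuous_image continuous_intros) (auto simp: compact_Int_closed)
  then have K2: "compactin (interval b) K2"
    by (auto simp: compactin_subtopology K2_def)
  have U1: "openin (interval a') U1"
    using V by (auto simp: U1_def openin_open)
  have "open ((\<lambda>t. a' + t) -` V)"
    using V by (intro open_vimage continuous_intros)
  then have U2: "openin (interval b') U2"
    by (auto simp: U2_def openin_open)
  define A where
    "A = {f \<in> extensional {0..a}. continuous_map (interval a) (interval a') f \<and> f ` K1 \<subseteq> U1}"
  define B where
    "B = {f \<in> extensional {0..b}. continuous_map (interval b) (interval b') f \<and> f ` K2 \<subseteq> U2}"
  have "openin (compact_open_topology (interval a) (interval a')) A"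
    using openin_compact_open_topology [OF K1 U1] by (simp add: A_def)
  moreover have "openin (compact_open_topology (interval b) (interval b')) B"
    using openin_compact_open_topology [OF K2 U2] by (simp add: B_def)
  ultimately have "openin T ((M_maps a a' \<inter> A) \<times> (M_maps b b' \<inter> B))"
    unfolding T_def by (simp add: openin_prod_Times_iff openin_subtopology_Int2)
  moreover have "{t \<in> topspace T. ?F t ` K \<subseteq> U} = (M_maps a a' \<inter> A) \<times> (M_maps b b' \<inter> B)"
  proof -
    have "tensor_map a a' b b' \<alpha> \<beta> ` K \<subseteq> U \<longleftrightarrow> \<alpha> ` K1 \<subseteq> U1 \<and> \<beta> ` K2 \<subseteq> U2"
      if M: "\<alpha> \<in> M_maps a a'" "\<beta> \<in> M_maps b b'" for \<alpha> \<beta>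
    proof -
      note c = tensor_map_cases [OF M pos]
      have "K = K1 \<union> (K \<inter> {a..a+b})" using K' by (auto simp: K1_def)
      then have "tensor_map a a' b b' \<alpha> \<beta> ` K \<subseteq> U \<longleftrightarrow>
          (\<forall>t\<in>K1. tensor_map a a' b b' \<alpha> \<beta> t \<in> U) \<and>
          (\<forall>t\<in>K \<inter> {a..a+b}. tensor_map a a' b b' \<alpha> \<beta> t \<in> U)"
        by blast
      also have "\<dots> \<longleftrightarrow> (\<forall>t\<in>K1. \<alpha> t \<in> U) \<and> (\<forall>t\<in>K \<inter> {a..a+b}. a' + \<beta> (t - a) \<in> U)"
        using c by (auto simp: K1_def)
      also have "(\<forall>t\<in>K1. \<alpha> t \<in> U) \<longleftrightarrow> \<alpha> ` K1 \<subseteq> U1"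
        using M_maps_bounds [OF M(1)] pos by (force simp: K1_def U1_def V(2))
      also have "(\<forall>t\<in>K \<inter> {a..a+b}. a' + \<beta> (t - a) \<in> U) \<longleftrightarrow> \<beta> ` K2 \<subseteq> U2"
      proof -
        have "a' + \<beta> (t - a) \<in> U \<longleftrightarrow> \<beta> (t - a) \<in> U2" if "t \<in> K \<inter> {a..a+b}" for t
          using that M_maps_bounds [OF M(2), of "t - a"] pos by (simp add: U2_def V(2))
        then show ?thesis by (simp add: K2_def image_subset_iff)
      qed
      finally show ?thesis .
    qed
    moreover have "(\<alpha>, \<beta>) \<in> topspace T \<longleftrightarrow> \<alpha> \<in> M_maps a a' \<and> \<beta> \<in> M_maps b b'" for \<alpha> \<beta>
      unfolding T_def topspace_prod_topology topspace_subtopology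
      using M_maps_compact_open by blast
    moreover have "\<alpha> \<in> A \<longleftrightarrow> \<alpha> ` K1 \<subseteq> U1" if "\<alpha> \<in> M_maps a a'" for \<alpha>
      using subsetD [OF M_maps_compact_open that] by (simp add: A_def)
    moreover have "\<beta> \<in> B \<longleftrightarrow> \<beta> ` K2 \<subseteq> U2" if "\<beta> \<in> M_maps b b'" for \<beta>
      using subsetD [OF M_maps_compact_open that] by (simp add: B_def)
    ultimately have "(\<alpha>, \<beta>) \<in> {t \<in> topspace T. ?F t ` K \<subseteq> U} \<longleftrightarrow>
        (\<alpha>, \<beta>) \<in> (M_maps a a' \<inter> A) \<times> (M_maps b b' \<inter> B)" for \<alpha> \<beta>
      unfolding mem_Collect_eq prod.case mem_Times_iff fst_conv snd_conv Int_iff by meson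
    then show ?thesis
      by (simp only: set_eq_iff split_paired_All simp_thms)
  qed
  ultimately show "openin T {t \<in> topspace T. ?F t ` K \<subseteq> U}" by simp
qed

lemma enriched_tensor_category_interval_category:
  assumes sub: "\<And>a b. H a b \<subseteq> M_maps a b"
    and ident: "\<And>a. (\<lambda>t\<in>{0..a}. t) \<in> H a a"
    and comp: "\<And>a b c f g. \<lbrakk>f \<in> H a b; g \<in> H b c\<rbrakk> \<Longrightarrow> compose {0..a} g f \<in> H a c"
    and tens: "\<And>a a' b b' f g. \<lbrakk>f \<in> H a a'; g \<in> H b b'; 0 < a; 0 < a'; 0 < b; 0 < b'\<rbrakk>
                 \<Longrightarrow> tensor_map a a' b b' f g \<in> H (a + b) (a' + b')"
  shows "enriched_tensor_category (interval_category H)"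
proof -
  let ?CO = "\<lambda>a b. compact_open_topology (interval a) (interval b)"
  let ?S = "\<lambda>a b. subtopology (?CO a b) (H a b)"
  have top: "topspace (?S a b) = H a b" for a b
    unfolding topspace_subtopology using sub [of a b] M_maps_compact_open [of a b] by blast
  have bounds: "0 \<le> f t \<and> f t \<le> b" if "f \<in> H a b" "t \<in> {0..a}" for f a b t
    using that M_maps_bounds sub by (metis atLeastAtMost_iff subsetD)
  have exten: "f \<in> extensional {0..a}" if "f \<in> H a b" for f a b
    using that sub by (auto simp: M_maps_def)
  have cont_comp: "continuous_map (prod_topology (?S b c) (?S a b)) (?S a c)
      (\<lambda>(g, f). compose {0..a} g f)" for a b c
  proof (rule continuous_map_into_subtopology)
    have "continuous_map (prod_topology (?CO b c) (?CO a b)) (?CO a c)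
        (\<lambda>(g, f). compose {0..a} g f)"
      using continuous_map_compose_compact_open [of "interval b" "interval c" "interval a"]
      by (simp add: compact_space_subtopology Hausdorff_space_subtopology)
    then show "continuous_map (prod_topology (?S b c) (?S a b)) (?CO a c)
        (\<lambda>(g, f). compose {0..a} g f)"
      by (simp add: continuous_map_from_subtopology flip: subtopology_Times)
  qed (use comp in \<open>auto simp: top\<close>)
  have cont_tens: "continuous_map (prod_topology (?S a a') (?S b b')) (?S (a + b) (a' + b'))
      (\<lambda>(f, g). tensor_map a a' b b' f g)" if "0 < a" "0 < a'" "0 < b" "0 < b'" for a a' b b'
  proof (rule continuous_map_into_subtopology)
    have "prod_topology (?S a a') (?S b b') = subtopology
        (prod_topology (subtopology (?CO a a') (M_maps a a')) (subtopology (?CO b b') (M_maps b b')))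
        (H a a' \<times> H b b')"
      using sub by (simp add: subtopology_Times subtopology_subtopology inf.absorb2)
    then show "continuous_map (prod_topology (?S a a') (?S b b')) (?CO (a + b) (a' + b'))
        (\<lambda>(f, g). tensor_map a a' b b' f g)"
      using continuous_map_tensor_map [OF that] by (simp add: continuous_map_from_subtopology)
  qed (use tens that in \<open>auto simp: top\<close>)
  have funct: "tensor_map a a'' b b'' (compose {0..a} f' f) (compose {0..b} g' g) =
      compose {0..a+b} (tensor_map a' a'' b' b'' f' g') (tensor_map a a' b b' f g)"
    if "f \<in> H a a'" "f' \<in> H a' a''" "g \<in> H b b'" "g' \<in> H b' b''"
      and pos: "0 < a" "0 < a'" "0 < a''" "0 < b" "0 < b'" "0 < b''"
    for a a' a'' b b' b'' f f' g g'
  proof (rule extensionalityI [of _ "{0..a+b}"])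
    have M: "f \<in> M_maps a a'" "f' \<in> M_maps a' a''" "g \<in> M_maps b b'" "g' \<in> M_maps b' b''"
      using that sub by blast+
    fix t assume t: "t \<in> {0..a+b}"
    show "tensor_map a a'' b b'' (compose {0..a} f' f) (compose {0..b} g' g) t =
        compose {0..a+b} (tensor_map a' a'' b' b'' f' g') (tensor_map a a' b b' f g) t"
    proof (cases "t \<le> a")
      case True
      then show ?thesis
        using t bounds [OF that(1), of t] pos by (simp add: tensor_map_def compose_def)
    next
      case False
      then show ?thesis
        using t bounds [OF that(3), of "t - a"] pos
          tensor_map_cases(2) [OF M(2) M(4), of "a' + g (t - a)"]
        by (simp add: tensor_map_def [of a] compose_def)
    qed
  qed (simp_all add: tensor_map_def)
  have assoc: "tensor_map (a + b) (a' + b') c c' (tensor_map a a' b b' f g) h =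
      tensor_map a a' (b + c) (b' + c') f (tensor_map b b' c c' g h)"
    if "0 < a" "0 < b" "0 < c" for a a' b b' c c' f g h
    by (rule ext) (use that in \<open>auto simp: tensor_map_def diff_diff_eq add.assoc\<close>)
  have ident_tens: "tensor_map a a b b (\<lambda>t\<in>{0..a}. t) (\<lambda>t\<in>{0..b}. t) = (\<lambda>t\<in>{0..a+b}. t)"
    if "0 < a" "0 < b" for a b
    by (rule ext) (use that in \<open>auto simp: tensor_map_def\<close>)
  have units: "compose {0..a} f (\<lambda>t\<in>{0..a}. t) = f" "compose {0..a} (\<lambda>t\<in>{0..b}. t) f = f"
    if "f \<in> H a b" for a b f
    using exten [OF that] bounds [OF that]
    by (auto intro!: extensionalityI [of _ "{0..a}"] simp: compose_def)
  have comp_assoc: "compose {0..a} h (compose {0..a} g f) = compose {0..a} (compose {0..b} h g) f"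
    if "f \<in> H a b" for a b f g h
    using bounds [OF that] by (auto simp: compose_def fun_eq_iff)
  have "enriched_category (interval_category H)"
    unfolding enriched_category_def interval_category_def
    using continuous_map_delta_prod [OF cont_comp] ident units
    by (simp add: top del: topspace_subtopology) (intro ballI comp_assoc)
  then show ?thesis
    unfolding enriched_tensor_category_def
    using continuous_map_delta_prod [OF cont_tens] funct assoc ident_tens
    by (simp add: interval_category_def top add.assoc del: topspace_subtopology)
qed

theorem enriched_tensor_category_G_cat: "enriched_tensor_category G_cat"
  unfolding G_cat_def
proof (rule enriched_tensor_category_interval_category)
  show "compose {0..a} g f \<in> G_maps a c" if "f \<in> G_maps a b" "g \<in> G_maps b c" for a b c f g
  proof -
    have "f ` {0..a} = {0..b}" using that by (simp add: G_maps_iff M_maps_def)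
    then have "inj_on (g \<circ> f) {0..a}" using that by (simp add: G_maps_iff comp_inj_on)
    moreover have "inj_on (compose {0..a} g f) {0..a} \<longleftrightarrow> inj_on (g \<circ> f) {0..a}"
      by (rule inj_on_cong) (simp add: compose_def)
    ultimately show ?thesis
      using that M_maps_compose [of f a b g c] by (simp add: G_maps_iff)
  qed
  show "G_maps a b \<subseteq> M_maps a b" for a b
    by (simp add: subset_iff G_maps_iff)
  show "(\<lambda>t\<in>{0..a}. t) \<in> G_maps a a" for a
    by (simp add: G_maps_iff M_maps_ident inj_on_def)
qed (rule G_maps_tensor)

theorem enriched_tensor_category_M_cat: "enriched_tensor_category M_cat"
  unfolding M_cat_def
  by (rule enriched_tensor_category_interval_category
      [OF subset_refl M_maps_ident M_maps_compose M_maps_tensor])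

end

theory Submission
  imports Defs
begin

text \<open>
  The point \<open>e\<close> where the two factors of \<open>e \<otimes> L\<close> meet is fixed by every map
  \<open>id\<^sub>e \<otimes> \<phi>\<close>. Naturality of \<open>\<lambda>\<close> therefore forces the single point \<open>p = \<lambda>\<^sub>L(e)\<close> of
  \<open>[0, L]\<close> to be fixed by every endomorphism \<open>\<phi>\<close> of \<open>L\<close>. Since \<open>\<lambda>\<^sub>L\<close> is injective and
  preserves end points, \<open>0 < p < L\<close>; but no interior point is fixed by all nondecreasing
  homeomorphisms of the interval: for \<open>L = 1\<close>, squaring fixes only the two end points.
  As squaring is a homeomorphism, the argument applies to every category of interval maps
  lying between \<open>\<G>\<close> and \<open>\<M>\<close>. Any unit structure would contain such a \<open>\<lambda>\<close>.
\<close>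

lemma Obj_interval_category: "Obj (interval_category H) = {0<..}"
  by (simp add: interval_category_def)

text \<open>
  Kelleyfication refines the topology of a hom-space and keeps its points, so the topological
  enrichment has no bearing on naturality.
\<close>

lemma Mor_interval_category:
  assumes "H a b \<subseteq> M_maps a b"
  shows "Mor (interval_category H) a b = H a b"
  using assms M_maps_compact_open [of a b]
  by (auto simp: interval_category_def simp del: topspace_compact_open_topology)

lemma isomorphism_interval_category_inj_on:
  assumes "isomorphism (interval_category H) a b f"
  shows "inj_on f {0..a}"
proof -
  obtain g where g: "compose {0..a} g f = (\<lambda>t\<in>{0..a}. t)"
    using assms by (auto simp: isomorphism_def interval_category_def)
  have "g (f t) = t" if "t \<in> {0..a}" for t
    using fun_cong [OF g, of t] that by (simp add: compose_def)
  then show ?thesis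
    by (rule inj_on_inverseI)
qed

lemma square_in_G_maps: "(\<lambda>t\<in>{0..1}. t\<^sup>2) \<in> G_maps 1 1"
proof -
  let ?f = "\<lambda>t\<in>{0..1}. t\<^sup>2 :: real"
  have "continuous_on {0..1} ?f"
    by (rule continuous_on_eq [of _ "\<lambda>t. t\<^sup>2"]) (auto intro: continuous_intros)
  moreover have "mono_on {0..1} ?f"
    by (auto simp: mono_on_def power_mono)
  moreover have "?f ` {0..1} = {0..1}"
  proof (intro equalityI subsetI)
    fix y :: real assume "y \<in> {0..1}"
    then have "sqrt y \<in> {0..1}" "y = ?f (sqrt y)" by auto
    then show "y \<in> ?f ` {0..1}" by blast
  qed (auto simp: power_le_one)
  moreover have "inj_on ?f {0..1}"
    by (auto simp: inj_on_def)
  ultimately show ?thesis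
    by (simp add: G_maps_iff M_maps_def)
qed

text \<open>
  Naturality with respect to the squaring map \<open>\<phi>\<close>, evaluated at the junction point \<open>e\<close> of
  \<open>[0, e + 1]\<close>, reads \<open>\<lambda>\<^sub>1(e) = \<phi>(\<lambda>\<^sub>1(e))\<close>, so \<open>\<lambda>\<^sub>1(e)\<close> is an end point of \<open>[0, 1]\<close>,
  which contradicts the injectivity of \<open>\<lambda>\<^sub>1\<close>.
\<close>

lemma no_left_unit_isomorphism:
  assumes GH: "\<And>a b. G_maps a b \<subseteq> H a b" and HM: "\<And>a b. H a b \<subseteq> M_maps a b"
    and e: "e \<in> Obj (interval_category H)"
  shows "\<not> natural_isomorphism (interval_category H) (interval_category H)
           (left_tensor (interval_category H) e) id_functor lam"
proof
  let ?C = "interval_category H"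
  assume nat: "natural_isomorphism ?C ?C (left_tensor ?C e) id_functor lam"
  have e: "0 < e" using e by (simp add: Obj_interval_category)
  define \<phi> where "\<phi> = (\<lambda>t\<in>{0..1}. t\<^sup>2 :: real)"
  define p where "p = lam 1 e"
  have \<phi>: "\<phi> \<in> H 1 1" using square_in_G_maps GH by (auto simp: \<phi>_def)
  have iso: "isomorphism ?C (e + 1) 1 (lam 1)"
    using nat by (simp add: natural_isomorphism_def left_tensor_def id_functor_def
        Obj_interval_category) (simp add: interval_category_def)
  then have lam: "lam 1 \<in> M_maps (e + 1) 1"
    using HM by (auto simp: isomorphism_def Mor_interval_category)
  have "compose {0..e+1} (lam 1) (tensor_map e e 1 1 (\<lambda>t\<in>{0..e}. t) \<phi>)
      = compose {0..e+1} \<phi> (lam 1)"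
  proof -
    have "\<phi> \<in> Mor ?C 1 1" using \<phi> HM by (simp add: Mor_interval_category)
    with nat have "Comp ?C (e + 1) (e + 1) 1 (lam 1) (TMor ?C e e 1 1 (Ident ?C e) \<phi>)
        = Comp ?C (e + 1) 1 1 \<phi> (lam 1)"
      unfolding natural_isomorphism_def left_tensor_def id_functor_def
      by (simp add: Obj_interval_category) (simp add: interval_category_def)
    then show ?thesis by (simp add: interval_category_def)
  qed
  \<comment> \<open>The tensor product fixes \<open>e\<close> because \<open>e\<close> still belongs to its left factor.\<close>
  from fun_cong [OF this, of e] have fixed: "p = \<phi> p"
    using e by (simp add: compose_def tensor_map_def p_def)
  moreover have "0 \<le> p" "p \<le> 1"
    using M_maps_bounds [OF lam, of e] e by (simp_all add: p_def)
  ultimately have "p = 0 \<or> p = 1"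
    by (auto simp: \<phi>_def power2_eq_square)
  moreover have "lam 1 0 = 0" "lam 1 (e + 1) = 1"
    using M_maps_ends [OF lam] e by simp_all
  then have "p \<noteq> 0" "p \<noteq> 1"
    using inj_onD [OF isomorphism_interval_category_inj_on [OF iso], of e 0]
      inj_onD [OF isomorphism_interval_category_inj_on [OF iso], of e "e + 1"] e
    by (auto simp: p_def)
  ultimately show False by blast
qed

theorem proposition9p1:
  shows "\<not> unital G_cat \<and> \<not> unital M_cat \<and>
    (\<forall>P\<in>{G_cat, M_cat}.
       \<not> (\<exists>e\<in>Obj P. \<exists>lam. natural_isomorphism P P (left_tensor P e) id_functor lam))"
proof -
  have GM: "G_maps a b \<subseteq> M_maps a b" for a b
    by (auto simp: G_maps_iff)
  have no_lam: "\<not> (\<exists>e\<in>Obj P. \<exists>lam. natural_isomorphism P P (left_tensor P e) id_functor lam)"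
    if "P \<in> {G_cat, M_cat}" for P
    using that no_left_unit_isomorphism [of G_maps] no_left_unit_isomorphism [of M_maps] GM
    unfolding G_cat_def M_cat_def by blast
  then have "\<not> unital P" if "P \<in> {G_cat, M_cat}" for P
    using that unfolding unital_def enriched_natural_isomorphism_def by blast
  with no_lam show ?thesis by blast
qed

end
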